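(* Let $K : V \to V$ be a linear, self-adjoint, positive definite operator, $C = K^{-1}$, and let $D : H \to V$ be the grid operator with adjoint $D^* : V \to H$ defined in the context. Let $u^0 \in H$, let $N \ge 1$ be an integer, $\tau > 0$, and let $\varphi^0, \varphi^1, \dots, \varphi^{N-1} \in H$. Consider the difference scheme with weight $\sigma \in \mathbb{R}$ for $\mathbf{g}^0, \mathbf{g}^1, \dots, \mathbf{g}^N \in V$: \[ C \frac{\mathbf{g}^{n+1} - \mathbf{g}^{n}}{\tau} + D D^* \bigl( \sigma \mathbf{g}^{n+1} + (1-\sigma) \mathbf{g}^{n} \bigr) = D \varphi^n, \quad n = 0,1,\dots,N-1, \qquad \mathbf{g}^0 = K D u^0 . \] If $\sigma \ge 0.5$, then the scheme is unconditionally stable: for every $\tau > 0$ (with no restriction relating $\tau$ to the grid steps) its solution satisfies \[ \|\mathbf{g}^{n+1}\|_C \le \|\mathbf{g}^{n}\|_C + \tau \| D \varphi^n \|_K, \quad n = 0,1,\dots,N-1 . \]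
   Context: Grid. Let $l_1, l_2 > 0$, let $N_1, N_2$ be positive integers and $h_\alpha = l_\alpha / N_\alpha$, $\alpha = 1,2$. Let $\overline{\omega} = \{ (i_1 h_1, i_2 h_2) : i_\alpha = 0,1,\dots,N_\alpha,\ \alpha = 1,2 \}$, let $\omega$ be its set of interior nodes ($1 \le i_\alpha \le N_\alpha - 1$), and $\partial\omega = \overline{\omega} \setminus \omega$. $H$ is the finite-dimensional real Hilbert space of grid functions $y$ on $\overline{\omega}$ with $y = 0$ on $\partial \omega$, with scalar product $(y,w) = \sum_{\bm{x} \in \omega} y(\bm{x}) w(\bm{x}) h_1 h_2$. Define the subgrids of points $(i_1 h_1, i_2 h_2)$: $\omega_1^+$: $0 \le i_1 \le N_1 - 1$, $1 \le i_2 \le N_2 - 1$; $\omega_1^-$: $1 \le i_1 \le N_1$, $1 \le i_2 \le N_2 - 1$; $\omega_2^+$: $1 \le i_1 \le N_1 - 1$, $0 \le i_2 \le N_2 - 1$; $\omega_2^-$: $1 \le i_1 \le N_1 - 1$, $1 \le i_2 \le N_2$. $H_\alpha^\pm$ is the space of real functions on $\omega_\alpha^\pm$ with scalar product $(y,w)_\alpha^\pm = \sum_{\bm{x} \in \omega_\alpha^\pm} y(\bm{x}) w(\bm{x}) h_1 h_2$. The space of grid vector functions is $V = H_1^+ \oplus H_1^- \oplus H_2^+ \oplus H_2^-$, with elements $\mathbf{q} = (q_1^+, q_1^-, q_2^+, q_2^-)^T$ and scalar product $(\mathbf{q}, \mathbf{g}) = \sum_{\alpha=1}^{2} \bigl(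 (q_\alpha^+, g_\alpha^+)_\alpha^+ + (q_\alpha^-, g_\alpha^-)_\alpha^- \bigr)$. Operators. With $e_\alpha$ the unit coordinate vector in direction $\alpha$, define $D_\alpha^\pm : H \to H_\alpha^\pm$ by $(D_\alpha^+ y)(\bm{x}) = - \dfrac{y(\bm{x} + h_\alpha e_\alpha) - y(\bm{x})}{h_\alpha}$ for $\bm{x} \in \omega_\alpha^+$, and $(D_\alpha^- y)(\bm{x}) = - \dfrac{y(\bm{x}) - y(\bm{x} - h_\alpha e_\alpha)}{h_\alpha}$ for $\bm{x} \in \omega_\alpha^-$. Set $D = (D_1^+, D_1^-, D_2^+, D_2^-)^T : H \to V$; $D^* = ((D_1^+)^*, (D_1^-)^*, (D_2^+)^*, (D_2^-)^* ) : V \to H$ is its adjoint. Norms. For a self-adjoint positive definite operator $S$ on $V$, $\|\mathbf{q}\|_S = (S \mathbf{q}, \mathbf{q})^{1/2}$. *)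

theory Defs
  imports "HOL-Analysis.Analysis" "HOL-Library.Function_Algebras"
begin

text \<open>Function_Algebras supplies the pointwise abelian group structure on functions; the
  pointwise scalar multiplication below makes them, and tuples of them, real vector spaces.\<close>

instantiation "fun" :: (type, real_vector) real_vector
begin

definition scaleR_fun :: "real \<Rightarrow> ('a \<Rightarrow> 'b) \<Rightarrow> 'a \<Rightarrow> 'b" where
  "scaleR_fun c f = (\<lambda>x. c *\<^sub>R f x)"

instance
  by standard (simp_all add: scaleR_fun_def fun_eq_iff scaleR_add_right scaleR_add_left)

end

text \<open>The spaces are linear subspaces \<open>X\<close>, \<open>Y\<close> of ambient vector spaces, with explicit scalar
  products \<open>ip\<close>. Operators are constrained on these subspaces only.\<close>

definition linear_map_on ::
    "'a::real_vector set \<Rightarrow> 'b::real_vector set \<Rightarrow> ('a \<Rightarrow> 'b) \<Rightarrow> bool" where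
  "linear_map_on X Y A \<longleftrightarrow> A \<in> X \<rightarrow> Y \<and>
     (\<forall>x\<in>X. \<forall>y\<in>X. A (x + y) = A x + A y) \<and> (\<forall>c. \<forall>x\<in>X. A (c *\<^sub>R x) = c *\<^sub>R A x)"

definition self_adjoint_on :: "'a set \<Rightarrow> ('a \<Rightarrow> 'a \<Rightarrow> real) \<Rightarrow> ('a \<Rightarrow> 'a) \<Rightarrow> bool" where
  "self_adjoint_on X ip A \<longleftrightarrow> (\<forall>x\<in>X. \<forall>y\<in>X. ip (A x) y = ip x (A y))"

definition pos_def_on :: "'a::zero set \<Rightarrow> ('a \<Rightarrow> 'a \<Rightarrow> real) \<Rightarrow> ('a \<Rightarrow> 'a) \<Rightarrow> bool" where
  "pos_def_on X ip A \<longleftrightarrow> (\<forall>x\<in>X. x \<noteq> 0 \<longrightarrow> ip (A x) x > 0)"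

text \<open>The adjoint of \<open>A : X \<rightarrow> Y\<close>; the description is proper for linear \<open>A\<close> when \<open>X\<close> is
  finite-dimensional and \<open>ipX\<close> is definite on \<open>X\<close>.\<close>

definition adjoint_on ::
    "'a set \<Rightarrow> ('a \<Rightarrow> 'a \<Rightarrow> real) \<Rightarrow> ('b \<Rightarrow> 'b \<Rightarrow> real) \<Rightarrow> ('a \<Rightarrow> 'b) \<Rightarrow> 'b \<Rightarrow> 'a" where
  "adjoint_on X ipX ipY A q = (THE v. v \<in> X \<and> (\<forall>y\<in>X. ipY (A y) q = ipX y v))"

text \<open>A function on a grid \<open>S\<close> is encoded as a function on the whole plane that vanishes off
  \<open>S\<close>, so that equality in the encoding is equality on \<open>S\<close>.\<close>

type_synonym grid_fun = "real \<times> real \<Rightarrow> real"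

text \<open>Components in the order (direction 1, plus), (1, minus), (2, plus), (2, minus).\<close>

type_synonym grid_vfun = "grid_fun \<times> grid_fun \<times> grid_fun \<times> grid_fun"

definition fun_on :: "(real \<times> real) set \<Rightarrow> grid_fun set" where
  "fun_on S = {y. \<forall>x. x \<notin> S \<longrightarrow> y x = 0}"

locale rect_grid =
  fixes l1 l2 :: real and N1 N2 :: nat
  assumes l1_pos: "l1 > 0" and l2_pos: "l2 > 0" and N1_pos: "N1 > 0" and N2_pos: "N2 > 0"
begin

definition h1 :: real where "h1 = l1 / real N1"
definition h2 :: real where "h2 = l2 / real N2"

definition nodes :: "nat set \<Rightarrow> nat set \<Rightarrow> (real \<times> real) set" where
  "nodes I J = {(real i * h1, real j * h2) | i j. i \<in> I \<and> j \<in> J}"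

definition omega_bar :: "(real \<times> real) set" where
  "omega_bar = nodes {0..N1} {0..N2}"

definition omega :: "(real \<times> real) set" where
  "omega = nodes {1..<N1} {1..<N2}"

definition bd_omega :: "(real \<times> real) set" where
  "bd_omega = omega_bar - omega"

definition omega1p :: "(real \<times> real) set" where
  "omega1p = nodes {0..<N1} {1..<N2}"

definition omega1m :: "(real \<times> real) set" where
  "omega1m = nodes {1..N1} {1..<N2}"

definition omega2p :: "(real \<times> real) set" where
  "omega2p = nodes {1..<N1} {0..<N2}"

definition omega2m :: "(real \<times> real) set" where
  "omega2m = nodes {1..<N1} {1..N2}"

definition ip_on :: "(real \<times> real) set \<Rightarrow> grid_fun \<Rightarrow> grid_fun \<Rightarrow> real" where
  "ip_on S y w = (\<Sum>x\<in>S. y x * w x * h1 * h2)"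

definition H :: "grid_fun set" where
  "H = {y \<in> fun_on omega_bar. \<forall>x\<in>bd_omega. y x = 0}"

definition ip_H :: "grid_fun \<Rightarrow> grid_fun \<Rightarrow> real" where
  "ip_H = ip_on omega"

definition V :: "grid_vfun set" where
  "V = fun_on omega1p \<times> fun_on omega1m \<times> fun_on omega2p \<times> fun_on omega2m"

definition ip_V :: "grid_vfun \<Rightarrow> grid_vfun \<Rightarrow> real" where
  "ip_V = (\<lambda>(q1p, q1m, q2p, q2m) (g1p, g1m, g2p, g2m).
     ip_on omega1p q1p g1p + ip_on omega1m q1m g1m +
     ip_on omega2p q2p g2p + ip_on omega2m q2m g2m)"

definition norm_V :: "(grid_vfun \<Rightarrow> grid_vfun) \<Rightarrow> grid_vfun \<Rightarrow> real" where
  "norm_V S q = sqrt (ip_V (S q) q)"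

definition D1p :: "grid_fun \<Rightarrow> grid_fun" where
  "D1p y = (\<lambda>x. if x \<in> omega1p then - ((y (x + (h1, 0)) - y x) / h1) else 0)"

definition D1m :: "grid_fun \<Rightarrow> grid_fun" where
  "D1m y = (\<lambda>x. if x \<in> omega1m then - ((y x - y (x - (h1, 0))) / h1) else 0)"

definition D2p :: "grid_fun \<Rightarrow> grid_fun" where
  "D2p y = (\<lambda>x. if x \<in> omega2p then - ((y (x + (0, h2)) - y x) / h2) else 0)"

definition D2m :: "grid_fun \<Rightarrow> grid_fun" where
  "D2m y = (\<lambda>x. if x \<in> omega2m then - ((y x - y (x - (0, h2))) / h2) else 0)"

definition D :: "grid_fun \<Rightarrow> grid_vfun" where
  "D y = (D1p y, D1m y, D2p y, D2m y)"

definition Dstar :: "grid_vfun \<Rightarrow> grid_fun" where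
  "Dstar = adjoint_on H ip_H ip_V D"

end

end

theory Submission
  imports Defs
begin

text \<open>Let \<open>\<langle>p, q\<rangle> = (C p, q)\<close>, \<open>v = \<sigma> g\<^sup>n\<^sup>+\<^sup>1 + (1 - \<sigma>) g\<^sup>n\<close>, \<open>b = \<tau> K D \<phi>\<^sup>n\<close> and \<open>a = \<tau> K D D\<^sup>* v\<close>. The scheme reads
  \<open>g\<^sup>n\<^sup>+\<^sup>1 = g\<^sup>n + b - a\<close>, so \<open>v = y - \<sigma> a\<close> with \<open>y = g\<^sup>n + \<sigma> b\<close>. Nonnegativity of \<open>D D\<^sup>*\<close> gives
  \<open>\<langle>a, v\<rangle> \<ge> 0\<close>, i.e. \<open>a\<close> lies in the ball with diameter from \<open>0\<close> to \<open>y / \<sigma>\<close>. Writing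
  \<open>a = y / (2 \<sigma>) - r\<close>, where \<open>r\<close> is no longer than \<open>y / (2 \<sigma>)\<close>, one gets
  \<open>g\<^sup>n\<^sup>+\<^sup>1 = (1 - 1 / (2 \<sigma>)) g\<^sup>n + b / 2 + r\<close>; the first coefficient is nonnegative for
  \<open>\<sigma> \<ge> 1/2\<close>, and the triangle inequality finishes the proof.\<close>

section \<open>Semi-inner products on a subspace and the abstract one-step estimate\<close>

locale semi_inner_on =
  fixes X :: "'a::real_vector set" and B :: "'a \<Rightarrow> 'a \<Rightarrow> real"
  assumes subspace: "subspace X"
    and commute: "\<And>x y. x \<in> X \<Longrightarrow> y \<in> X \<Longrightarrow> B x y = B y x"
    and add_left: "\<And>x y z. x \<in> X \<Longrightarrow> y \<in> X \<Longrightarrow> z \<in> X \<Longrightarrow> B (x + y) z = B x z + B y z"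
    and scale_left: "\<And>c x y. x \<in> X \<Longrightarrow> y \<in> X \<Longrightarrow> B (c *\<^sub>R x) y = c * B x y"
    and nonneg: "\<And>x. x \<in> X \<Longrightarrow> 0 \<le> B x x"
begin

lemmas closed = subspace_add[OF subspace] subspace_diff[OF subspace] subspace_scale[OF subspace]

lemma add_right: "x \<in> X \<Longrightarrow> y \<in> X \<Longrightarrow> z \<in> X \<Longrightarrow> B z (x + y) = B z x + B z y"
  by (metis add_left commute closed(1))

lemma scale_right: "x \<in> X \<Longrightarrow> y \<in> X \<Longrightarrow> B y (c *\<^sub>R x) = c * B y x"
  by (metis scale_left commute closed(3))

lemma diff_left: "x \<in> X \<Longrightarrow> y \<in> X \<Longrightarrow> z \<in> X \<Longrightarrow> B (x - y) z = B x z - B y z"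
  by (metis add_left closed(2) add_diff_cancel_right' diff_add_cancel)

lemma diff_right: "x \<in> X \<Longrightarrow> y \<in> X \<Longrightarrow> z \<in> X \<Longrightarrow> B z (x - y) = B z x - B z y"
  by (metis diff_left commute closed(2))

lemmas bilinear = add_left add_right scale_left scale_right diff_left diff_right

definition seminorm :: "'a \<Rightarrow> real" where
  "seminorm x = sqrt (B x x)"

lemma seminorm_nonneg: "x \<in> X \<Longrightarrow> 0 \<le> seminorm x"
  by (simp add: seminorm_def nonneg)

lemma seminorm_power2: "x \<in> X \<Longrightarrow> (seminorm x)\<^sup>2 = B x x"
  by (simp add: seminorm_def nonneg)

lemma seminorm_scale: "x \<in> X \<Longrightarrow> seminorm (c *\<^sub>R x) = \<bar>c\<bar> * seminorm x"
  by (simp add: seminorm_def bilinear closed real_sqrt_mult flip: mult.assoc)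

text \<open>The quadratic \<open>t \<mapsto> B (t *\<^sub>R x + y) (t *\<^sub>R x + y)\<close> is
  never negative. Definiteness is not assumed, so a vanishing leading coefficient
  \<open>B x x\<close> is a separate case.\<close>

lemma Cauchy_Schwarz:
  assumes x: "x \<in> X" and y: "y \<in> X"
  shows "B x y \<le> seminorm x * seminorm y"
proof -
  have quad: "0 \<le> B x x * t\<^sup>2 + 2 * B x y * t + B y y" for t
    using nonneg[of "t *\<^sub>R x + y"] x y commute[OF x y]
    by (simp add: bilinear closed power2_eq_square algebra_simps)
  have "(B x y)\<^sup>2 \<le> B x x * B y y"
  proof (cases "B x x = 0")
    case True
    have "B x y = 0"
    proof (rule ccontr)
      assume "B x y \<noteq> 0"
      \<comment> \<open>The quadratic has become affine, and at this \<open>t\<close> its value is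
        -1.\<close>
      then show False
        using quad[of "- (B y y + 1) / (2 * B x y)"] True by (simp add: field_simps)
    qed
    then show ?thesis using True by simp
  next
    case False
    then have pos: "B x x > 0" using nonneg[OF x] by simp
    \<comment> \<open>The chosen \<open>t\<close> minimises the quadratic; the factor
      \<open>B x x\<close> clears the denominator.\<close>
    have "0 \<le> B x x * (B x x * (- B x y / B x x)\<^sup>2 + 2 * B x y * (- B x y / B x x) + B y y)"
      by (intro mult_nonneg_nonneg[OF less_imp_le[OF pos]] quad)
    also have "\<dots> = B x x * B y y - (B x y)\<^sup>2"
      using pos by (simp add: field_simps power2_eq_square)
    finally show ?thesis by simp
  qed
  then show ?thesis
    using real_le_rsqrt by (simp add: seminorm_def flip: real_sqrt_mult)
qed

lemma seminorm_triangle: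
  assumes x: "x \<in> X" and y: "y \<in> X"
  shows "seminorm (x + y) \<le> seminorm x + seminorm y"
proof (rule power2_le_imp_le)
  show "(seminorm (x + y))\<^sup>2 \<le> (seminorm x + seminorm y)\<^sup>2"
    using Cauchy_Schwarz[OF x y] x y commute[OF x y]
    by (simp add: seminorm_power2 power2_sum bilinear closed)
qed (use x y in \<open>simp add: seminorm_nonneg\<close>)

text \<open>This isolates the estimate from the grid: \<open>z\<close>, \<open>b\<close>,
  \<open>a\<close> stand for the old value, the source increment and the dissipative increment, and
  the vector paired with \<open>a\<close> in \<open>accretive\<close> is the weighted average of old
  and new values.\<close>

lemma weighted_step_bound:
  assumes z: "z \<in> X" and b: "b \<in> X" and a: "a \<in> X" and \<sigma>: "\<sigma> \<ge> 1 / 2"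
    and accretive: "0 \<le> B a (z + \<sigma> *\<^sub>R b - \<sigma> *\<^sub>R a)"
  shows "seminorm (z + b - a) \<le> seminorm z + seminorm b"
proof -
  have pos: "\<sigma> > 0" using \<sigma> by simp
  define s where "s = 1 / (2 * \<sigma>)"
  have s: "0 < s" "s \<le> 1" "s * \<sigma> = 1 / 2" using \<sigma> by (auto simp: s_def field_simps)
  define y where "y = z + \<sigma> *\<^sub>R b"
  define r where "r = s *\<^sub>R y - a"
  have y: "y \<in> X" and r: "r \<in> X" using z b a by (auto simp: y_def r_def closed)
  have "\<sigma> * B a a \<le> B a y"
    using accretive y a by (simp add: bilinear closed flip: y_def)
  then have "2 * s * (\<sigma> * B a a) \<le> 2 * s * B a y" using s by simp
  moreover have "2 * s * (\<sigma> * B a a) = B a a" using pos by (simp add: s_def)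
  ultimately have "B a a \<le> 2 * s * B a y" by simp
  \<comment> \<open>Expanding the square, \<open>B r r\<close> exceeds
    \<open>B (s *\<^sub>R y) (s *\<^sub>R y)\<close> by \<open>B a a - 2 * s * B a y\<close>, which
    is at most 0.\<close>
  then have "B r r \<le> B (s *\<^sub>R y) (s *\<^sub>R y)"
    using y a commute[OF a y] by (simp add: r_def bilinear closed algebra_simps)
  then have "seminorm r \<le> seminorm (s *\<^sub>R y)" by (simp add: seminorm_def)
  also have "\<dots> = s * seminorm y" using y s by (simp add: seminorm_scale)
  also have "\<dots> \<le> s * (seminorm z + \<sigma> * seminorm b)"
    using seminorm_triangle[of z "\<sigma> *\<^sub>R b"] z b pos s
    by (simp add: y_def seminorm_scale closed)
  also have "\<dots> = s * seminorm z + seminorm b / 2"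
    using s(3) by (simp add: distrib_left flip: mult.assoc)
  finally have r_le: "seminorm r \<le> s * seminorm z + seminorm b / 2" .
  have "z + b - a = ((1 - s) *\<^sub>R z + (1 / 2) *\<^sub>R b) + r"
  proof -
    \<comment> \<open>With half of \<open>b\<close> as a single vector, the identity reduces to
      cancellation in an abelian group.\<close>
    define c where "c = (1 / 2 :: real) *\<^sub>R b"
    have "r = s *\<^sub>R z + c - a"
      by (simp add: r_def y_def c_def scaleR_add_right s(3))
    moreover have "b = c + c" unfolding c_def by (simp flip: scaleR_add_left)
    ultimately show ?thesis
      unfolding c_def[symmetric] by (simp add: scaleR_diff_left)
  qed
  then have "seminorm (z + b - a) \<le> seminorm ((1 - s) *\<^sub>R z + (1 / 2) *\<^sub>R b) + seminorm r"
    using z b r by (simp add: seminorm_triangle closed)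
  \<comment> \<open>For positive \<sigma>, \<open>s \<le> 1\<close> is equivalent to
    \<open>\<sigma> \<ge> 1 / 2\<close>; it lets \<open>1 - s\<close> leave the seminorm without an
    absolute value.\<close>
  also have "seminorm ((1 - s) *\<^sub>R z + (1 / 2) *\<^sub>R b) \<le> (1 - s) * seminorm z + seminorm b / 2"
    using seminorm_triangle[of "(1 - s) *\<^sub>R z" "(1 / 2) *\<^sub>R b"] z b s
    by (simp add: seminorm_scale closed)
  finally show ?thesis using r_le by (simp add: algebra_simps)
qed

end

section \<open>Linear algebra on finite-dimensional subspaces\<close>

lemma injective_endomorphism_surjective:
  fixes X :: "'a::real_vector set"
  assumes sub: "subspace X" and T: "finite T" "X \<subseteq> span T"
    and A: "linear_map_on X X A" and inj: "inj_on A X"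
  shows "A ` X = X"
proof -
  obtain E where E: "E \<subseteq> X" "independent E" "X \<subseteq> span E"
    using maximal_independent_subset[of X] by blast
  have X_eq: "X = span E" using E sub by (meson span_minimal subset_antisym)
  have fin: "finite E" using independent_span_bound[OF T(1) E(2)] E(1) T(2) by blast
  \<comment> \<open>\<open>A\<close> is linear only on \<open>X\<close>; a globally linear
    \<open>A'\<close> with the same values on the basis \<open>E\<close> opens the way to the theory
    of \<open>linear\<close>, and agrees with \<open>A\<close> on all of \<open>X\<close>.\<close>
  obtain A' where A': "linear A'" "\<And>x. x \<in> E \<Longrightarrow> A' x = A x"
    using linear_independent_extend[OF E(2), of A] by blast
  have A'_eq: "A' x = A x" if "x \<in> X" for x
  proof -
    have "x \<in> X \<and> A' x = A x"
    proof (rule span_induct_alt[of x E])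
      show "x \<in> span E" using that X_eq by simp
      show "0 \<in> X \<and> A' 0 = A 0"
        using A sub linear_0[OF A'(1)] subspace_0[OF sub]
        unfolding linear_map_on_def by (metis scaleR_zero_left)
      show "c *\<^sub>R x + y \<in> X \<and> A' (c *\<^sub>R x + y) = A (c *\<^sub>R x + y)"
        if "x \<in> E" "y \<in> X \<and> A' y = A y" for c x y
        using that A E(1) A'(2) unfolding linear_map_on_def
        by (auto simp: linear_add[OF A'(1)] linear_scale[OF A'(1)] subset_iff
            subspace_add[OF sub] subspace_scale[OF sub])
    qed
    then show ?thesis ..
  qed
  have inj': "inj_on A' (span E)" using inj A'_eq X_eq by (simp add: inj_on_def)
  have ind: "independent (A' ` E)"
    by (rule linear_independent_injective_image[OF A'(1) E(2) inj'])
  have card: "card (A' ` E) = card E"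
    by (meson card_image inj' inj_on_subset span_superset)
  have img: "A' ` E \<subseteq> X" using A E(1) A'(2) unfolding linear_map_on_def by auto
  \<comment> \<open>Dimension count: a vector of \<open>X\<close> outside this span would yield
    \<open>card E + 1\<close> independent vectors inside \<open>span E\<close>.\<close>
  have "X \<subseteq> span (A' ` E)"
  proof (rule ccontr)
    assume "\<not> X \<subseteq> span (A' ` E)"
    then obtain x where x: "x \<in> X" "x \<notin> span (A' ` E)" by blast
    then have "independent (insert x (A' ` E))" using ind by (simp add: independent_insert)
    then have "card (insert x (A' ` E)) \<le> card E"
      using independent_span_bound[OF fin] x(1) img X_eq by blast
    moreover have "x \<notin> A' ` E" using x(2) span_base[of x "A' ` E"] by auto
    ultimately show False using fin card by simp
  qed
  then have "X \<subseteq> A' ` X" using linear_span_image[OF A'(1), of E] X_eq by simp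
  moreover have "A ` X \<subseteq> X" using A unfolding linear_map_on_def by auto
  moreover have "A' ` X = A ` X" using A'_eq by (rule image_cong[OF refl])
  ultimately show ?thesis by simp
qed

lemma finite_span_Times:
  fixes X :: "'a::real_vector set" and Y :: "'b::real_vector set"
  assumes "finite S" "X \<subseteq> span S" "finite T" "Y \<subseteq> span T"
  shows "\<exists>U. finite U \<and> X \<times> Y \<subseteq> span U"
proof (intro exI conjI subsetI)
  let ?U = "(\<lambda>x. (x, 0)) ` S \<union> (\<lambda>y. (0, y)) ` T"
  show "finite ?U" using assms by simp
  fix p assume "p \<in> X \<times> Y"
  then have *: "fst p \<in> span S" "snd p \<in> span T" using assms by auto
  have lin: "linear (\<lambda>x::'a. (x, 0::'b))" "linear (\<lambda>y::'b. (0::'a, y))"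
    by (auto intro!: linearI)
  have "(fst p, 0::'b) \<in> span ((\<lambda>x. (x, 0)) ` S)"
    unfolding linear_span_image[OF lin(1)] using *(1) by (rule imageI)
  moreover have "(0::'a, snd p) \<in> span ((\<lambda>y. (0, y)) ` T)"
    unfolding linear_span_image[OF lin(2)] using *(2) by (rule imageI)
  ultimately have "(fst p, 0) + (0, snd p) \<in> span ?U"
    by (meson span_add span_mono sup_ge1 sup_ge2 subsetD)
  then show "p \<in> span ?U" by simp
qed

lemma linear_map_on_sum:
  assumes "linear_map_on X Y A" "subspace X" "finite I" "\<And>i. i \<in> I \<Longrightarrow> f i \<in> X"
  shows "A (\<Sum>i\<in>I. c i *\<^sub>R f i) = (\<Sum>i\<in>I. c i *\<^sub>R A (f i))"
  using assms(3,4)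
proof (induction I rule: finite_induct)
  case empty
  have "A (0 *\<^sub>R 0) = 0 *\<^sub>R A 0"
    using assms(1) subspace_0[OF assms(2)] unfolding linear_map_on_def by blast
  then show ?case by simp
next
  case (insert j I)
  have "(\<Sum>i\<in>I. c i *\<^sub>R f i) \<in> X" "c j *\<^sub>R f j \<in> X"
    using insert assms(2) by (auto intro!: subspace_sum subspace_scale)
  then show ?case using insert assms(1) unfolding linear_map_on_def by simp
qed

section \<open>Nodal basis of the grid functions\<close>

definition delta :: "real \<times> real \<Rightarrow> grid_fun" where
  "delta p = (\<lambda>x. if x = p then 1 else 0)"

lemma sum_fun_apply: "(\<Sum>i\<in>I. f i) x = (\<Sum>i\<in>I. f i x)" for f :: "'i \<Rightarrow> 'a \<Rightarrow> 'b::comm_monoid_add"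
  by (induction I rule: infinite_finite_induct) auto

lemma delta_fun_on: "p \<in> S \<Longrightarrow> delta p \<in> fun_on S"
  by (auto simp: delta_def fun_on_def)

lemma fun_on_expand:
  assumes "finite S" "y \<in> fun_on S"
  shows "y = (\<Sum>p\<in>S. y p *\<^sub>R delta p)"
  using assms by (auto simp: fun_eq_iff sum_fun_apply scaleR_fun_def delta_def fun_on_def
      if_distrib cong: if_cong)

lemma subspace_fun_on: "subspace (fun_on S)"
  by (auto simp: subspace_def fun_on_def scaleR_fun_def)

lemma fun_on_subset_span:
  assumes "finite S"
  shows "fun_on S \<subseteq> span (delta ` S)"
proof
  fix y assume "y \<in> fun_on S"
  moreover have "(\<Sum>p\<in>S. y p *\<^sub>R delta p) \<in> span (delta ` S)"
    by (intro span_sum span_scale span_base imageI)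
  ultimately show "y \<in> span (delta ` S)" using fun_on_expand[OF assms] by metis
qed

section \<open>Grid spaces, their scalar products, and the adjoint of the difference
  operator\<close>

context rect_grid
begin

lemma h1_pos: "h1 > 0" and h2_pos: "h2 > 0"
  using l1_pos l2_pos N1_pos N2_pos by (auto simp: h1_def h2_def)

lemma finite_nodes: "finite I \<Longrightarrow> finite J \<Longrightarrow> finite (nodes I J)"
  by (rule finite_subset[of _ "(\<lambda>(i, j). (real i * h1, real j * h2)) ` (I \<times> J)"])
    (auto simp: nodes_def)

lemma finite_grids:
  "finite omega" "finite omega1p" "finite omega1m" "finite omega2p" "finite omega2m"
  by (simp_all add: omega_def omega1p_def omega1m_def omega2p_def omega2m_def finite_nodes)

text \<open>Zero boundary values merge with the zero extension off the grid, so \<open>H\<close>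
  falls under the general facts on \<open>fun_on\<close>.\<close>

lemma H_eq: "H = fun_on omega"
proof -
  have "omega \<subseteq> omega_bar"
    unfolding omega_def omega_bar_def nodes_def by force
  then show ?thesis by (auto simp: H_def fun_on_def bd_omega_def)
qed

lemma subspace_V: "subspace V"
  unfolding V_def by (intro subspace_Times subspace_fun_on)

text \<open>The ambient functions on the plane form an infinite-dimensional space, so finite
  dimension of \<open>V\<close> is expressed by a finite spanning set, built factor by
  factor.\<close>

lemma V_finite_span: "\<exists>T. finite T \<and> V \<subseteq> span T"
proof -
  have fin: "\<exists>T. finite T \<and> fun_on S \<subseteq> span T" if "finite S" for S
    using fun_on_subset_span[OF that] that by blast
  then show ?thesis
    unfolding V_def using finite_grids
    by (elim fin[THEN exE] conjE) (metis finite_span_Times)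
qed

lemma ip_on_add_left: "ip_on S (x + y) z = ip_on S x z + ip_on S y z"
  by (simp add: ip_on_def algebra_simps sum.distrib)

lemma ip_on_scale_left: "ip_on S (c *\<^sub>R x) y = c * ip_on S x y"
  by (simp add: ip_on_def scaleR_fun_def sum_distrib_left algebra_simps)

lemma ip_on_commute: "ip_on S x y = ip_on S y x"
  by (simp add: ip_on_def mult.commute)

lemma ip_on_nonneg: "0 \<le> ip_on S x x"
  using h1_pos h2_pos by (simp add: ip_on_def sum_nonneg)

lemma ip_on_eq_0D:
  assumes "finite S" "x \<in> fun_on S" "ip_on S x x = 0"
  shows "x = 0"
proof
  fix p
  have "\<forall>p\<in>S. x p * x p * h1 * h2 = 0"
    using assms h1_pos h2_pos by (subst (asm) ip_on_def, subst (asm) sum_nonneg_eq_0_iff) auto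
  then show "x p = 0 p"
    using assms(2) h1_pos h2_pos by (cases "p \<in> S"; cases p) (auto simp: fun_on_def)
qed

lemma ip_V_add_left: "ip_V (x + y) z = ip_V x z + ip_V y z"
  by (simp add: ip_V_def ip_on_add_left split: prod.splits)

lemma ip_V_scale_left: "ip_V (c *\<^sub>R x) y = c * ip_V x y"
  by (simp add: ip_V_def ip_on_scale_left distrib_left split: prod.splits)

lemma ip_V_commute: "ip_V x y = ip_V y x"
  by (simp add: ip_V_def ip_on_commute split: prod.splits)

lemma ip_V_zero_right: "ip_V x 0 = 0"
  using ip_V_scale_left[of 0 0 x] by (simp add: ip_V_commute)

lemma D_in_V: "D y \<in> V"
  by (simp add: D_def V_def fun_on_def D1p_def D1m_def D2p_def D2m_def)

lemma D_add: "D (x + y) = D x + D y"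
  using h1_pos h2_pos
  by (simp add: D_def D1p_def D1m_def D2p_def D2m_def fun_eq_iff field_simps)

lemma D_scale: "D (c *\<^sub>R x) = c *\<^sub>R D x"
  using h1_pos h2_pos
  by (simp add: D_def D1p_def D1m_def D2p_def D2m_def fun_eq_iff scaleR_fun_def field_simps)

lemma Riesz_fun_on:
  assumes S: "finite S" and f: "linear_map_on (fun_on S) UNIV f"
  shows "\<exists>v\<in>fun_on S. \<forall>y\<in>fun_on S. f y = ip_on S y v"
proof (intro bexI ballI)
  \<comment> \<open>Testing with \<open>delta p\<close> forces this value, since
    \<open>ip_on S (delta p) v\<close> is \<open>v p * h1 * h2\<close>.\<close>
  let ?v = "\<lambda>p. if p \<in> S then f (delta p) / (h1 * h2) else 0"
  show "?v \<in> fun_on S" by (simp add: fun_on_def)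
  fix y assume "y \<in> fun_on S"
  then have "f y = f (\<Sum>p\<in>S. y p *\<^sub>R delta p)" using fun_on_expand[OF S] by metis
  also have "\<dots> = (\<Sum>p\<in>S. y p *\<^sub>R f (delta p))"
    by (rule linear_map_on_sum[OF f subspace_fun_on S]) (rule delta_fun_on)
  also have "\<dots> = ip_on S y ?v"
    unfolding ip_on_def using h1_pos h2_pos by (intro sum.cong) auto
  finally show "f y = ip_on S y ?v" .
qed

text \<open>This discharges the definite description in \<open>adjoint_on\<close>: existence is
  Riesz representation on \<open>omega\<close>, uniqueness is definiteness of the scalar
  product.\<close>

lemma Dstar_spec: "Dstar q \<in> H \<and> (\<forall>y\<in>H. ip_V (D y) q = ip_H y (Dstar q))"
  unfolding Dstar_def adjoint_on_def
proof (rule theI'[of "\<lambda>v. v \<in> H \<and> (\<forall>y\<in>H. ip_V (D y) q = ip_H y v)"])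
  have "linear_map_on (fun_on omega) UNIV (\<lambda>y. ip_V (D y) q)"
    by (simp add: linear_map_on_def D_add D_scale ip_V_add_left ip_V_scale_left)
  then obtain v where v: "v \<in> fun_on omega" "\<forall>y\<in>fun_on omega. ip_V (D y) q = ip_on omega y v"
    using Riesz_fun_on[OF finite_grids(1)] by blast
  show "\<exists>!v. v \<in> H \<and> (\<forall>y\<in>H. ip_V (D y) q = ip_H y v)"
    unfolding H_eq ip_H_def
  proof (rule ex1I)
    fix w assume w: "w \<in> fun_on omega \<and> (\<forall>y\<in>fun_on omega. ip_V (D y) q = ip_on omega y w)"
    have mem: "w - v \<in> fun_on omega" using v w by (simp add: subspace_diff[OF subspace_fun_on])
    \<comment> \<open>Two representers are compared by testing with their own difference.\<close>
    have "ip_on omega (w - v) w = ip_on omega (w - v) v" using mem v w by metis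
    then have "ip_on omega (w - v) (w - v) = 0"
      using ip_on_add_left[of omega "w - v" v "w - v"] by (simp add: ip_on_commute)
    then have "w - v = 0" using ip_on_eq_0D[OF finite_grids(1) mem] by simp
    then show "w = v" by simp
  qed (use v in blast)
qed

text \<open>The adjoint identity at \<open>y = Dstar q\<close> turns this into the squared norm of
  \<open>Dstar q\<close> in \<open>H\<close>.\<close>

lemma D_Dstar_nonneg: "0 \<le> ip_V (D (Dstar q)) q"
  using Dstar_spec[of q] by (simp add: ip_H_def ip_on_nonneg)

section \<open>The operator \<open>K\<close>, its inverse \<open>C\<close>, and one step of the
  scheme\<close>

context
  fixes K :: "grid_vfun \<Rightarrow> grid_vfun"
  assumes K_linear: "linear_map_on V V K"
    and K_self_adjoint: "self_adjoint_on V ip_V K"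
    and K_pos_def: "pos_def_on V ip_V K"
begin

lemma K_closed: "x \<in> V \<Longrightarrow> K x \<in> V"
  using K_linear unfolding linear_map_on_def by auto

lemma K_add: "x \<in> V \<Longrightarrow> y \<in> V \<Longrightarrow> K (x + y) = K x + K y"
  using K_linear unfolding linear_map_on_def by blast

lemma K_scale: "x \<in> V \<Longrightarrow> K (c *\<^sub>R x) = c *\<^sub>R K x"
  using K_linear unfolding linear_map_on_def by blast

lemma K_diff: "x \<in> V \<Longrightarrow> y \<in> V \<Longrightarrow> K (x - y) = K x - K y"
  using K_add[of "x - y" y] by (simp add: subspace_diff[OF subspace_V])

text \<open>Positive definiteness on differences gives injectivity, and finite dimension then gives
  surjectivity. Hence \<open>the_inv_into V K\<close> is a genuine two-sided inverse on
  \<open>V\<close>.\<close>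

lemma bij_K: "bij_betw K V V"
proof -
  have "inj_on K V"
  proof (rule inj_onI, rule ccontr)
    fix x y assume xy: "x \<in> V" "y \<in> V" "K x = K y" "x \<noteq> y"
    then have "ip_V (K (x - y)) (x - y) > 0"
      using K_pos_def subspace_diff[OF subspace_V] unfolding pos_def_on_def by auto
    then show False
      using xy by (simp add: K_diff ip_V_commute[of 0] ip_V_zero_right)
  qed
  moreover obtain T where "finite T" "V \<subseteq> span T" using V_finite_span by blast
  ultimately show ?thesis
    using injective_endomorphism_surjective[OF subspace_V _ _ K_linear]
    by (simp add: bij_betw_def)
qed

abbreviation C :: "grid_vfun \<Rightarrow> grid_vfun" where
  "C \<equiv> the_inv_into V K"

lemma C_closed: "x \<in> V \<Longrightarrow> C x \<in> V"
  and K_C: "x \<in> V \<Longrightarrow> K (C x) = x"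
  and C_K: "x \<in> V \<Longrightarrow> C (K x) = x"
  using bij_K
  by (auto simp: bij_betw_def the_inv_into_f_f f_the_inv_into_f intro!: the_inv_into_into)

lemma C_eqI: "x \<in> V \<Longrightarrow> K x = y \<Longrightarrow> C y = x"
  using C_K by blast

text \<open>Each property passes from \<open>K\<close> to \<open>C\<close> by writing
  \<open>x\<close> as \<open>K (C x)\<close>; the associated seminorm is
  \<open>norm_V C\<close>.\<close>

lemma semi_inner_C: "semi_inner_on V (\<lambda>x y. ip_V (C x) y)"
proof
  show "subspace V" by (rule subspace_V)
  fix x y assume x: "x \<in> V" and y: "y \<in> V"
  have "ip_V (K (C x)) (C y) = ip_V (C x) (K (C y))"
    using K_self_adjoint x y C_closed unfolding self_adjoint_on_def by blast
  then show "ip_V (C x) y = ip_V (C y) x" using x y by (simp add: K_C ip_V_commute)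
  \<comment> \<open>Linearity of \<open>C\<close> follows by applying \<open>K\<close> to the
    proposed value.\<close>
  have "C (c *\<^sub>R x) = c *\<^sub>R C x" for c
    using x by (intro C_eqI) (simp_all add: C_closed K_C K_scale subspace_scale[OF subspace_V])
  then show "ip_V (C (c *\<^sub>R x)) y = c * ip_V (C x) y" for c by (simp add: ip_V_scale_left)
  have "C (x + y) = C x + C y"
    using x y by (intro C_eqI) (simp_all add: C_closed K_C K_add subspace_add[OF subspace_V])
  then show "ip_V (C (x + y)) z = ip_V (C x) z + ip_V (C y) z" for z by (simp add: ip_V_add_left)
next
  fix x assume x: "x \<in> V"
  have "0 \<le> ip_V (K (C x)) (C x)"
    using K_pos_def C_closed[OF x] unfolding pos_def_on_def
    by (cases "C x = 0") (auto simp: ip_V_zero_right less_imp_le)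
  then show "0 \<le> ip_V (C x) x" using x by (simp add: K_C ip_V_commute)
qed

text \<open>This is why the source is measured in the K-norm: it enters the solved scheme as
  \<open>K F\<close>, and \<open>C\<close> undoes that \<open>K\<close>.\<close>

lemma norm_V_C_K: "x \<in> V \<Longrightarrow> norm_V C (K x) = norm_V K x"
  by (simp add: norm_V_def C_K ip_V_commute)

text \<open>Applying \<open>K\<close> and multiplying by \<tau> solves the scheme for the new value,
  after which \<open>weighted_step_bound\<close> applies. Here \<open>y\<close> is the old value and
  \<open>z\<close> the new one, whereas there \<open>z\<close> is the old one.\<close>

lemma scheme_step:
  assumes y: "y \<in> V" and z: "z \<in> V" and F: "F \<in> V" and \<tau>: "\<tau> > 0" and \<sigma>: "\<sigma> \<ge> 1 / 2"
    and scheme: "C ((1 / \<tau>) *\<^sub>R (z - y)) + D (Dstar (\<sigma> *\<^sub>R z + (1 - \<sigma>) *\<^sub>R y)) = F"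
  shows "norm_V C z \<le> norm_V C y + \<tau> * norm_V K F"
proof -
  interpret semi_inner_on V "\<lambda>x y. ip_V (C x) y" by (rule semi_inner_C)
  define v where "v = \<sigma> *\<^sub>R z + (1 - \<sigma>) *\<^sub>R y"
  define A where "A = D (Dstar v)"
  define a where "a = \<tau> *\<^sub>R K A"
  define b where "b = \<tau> *\<^sub>R K F"
  have A: "A \<in> V" by (simp add: A_def D_in_V)
  have a: "a \<in> V" and b: "b \<in> V" using A F by (simp_all add: a_def b_def K_closed closed)
  have "C ((1 / \<tau>) *\<^sub>R (z - y)) = F - A"
    using scheme by (simp add: A_def v_def eq_diff_eq)
  then have "(1 / \<tau>) *\<^sub>R (z - y) = K F - K A"
    using K_C[of "(1 / \<tau>) *\<^sub>R (z - y)"] y z F A by (simp add: K_diff closed)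
  then have "\<tau> *\<^sub>R ((1 / \<tau>) *\<^sub>R (z - y)) = \<tau> *\<^sub>R (K F - K A)" by simp
  then have "z - y = b - a" using \<tau> by (simp add: a_def b_def scaleR_diff_right)
  then have z_eq: "z = y + b - a" by (simp add: algebra_simps)
  have v_eq: "v = y + \<sigma> *\<^sub>R b - \<sigma> *\<^sub>R a"
    unfolding v_def z_eq by (simp add: algebra_simps)
  have "a = K (\<tau> *\<^sub>R A)" using A by (simp add: a_def K_scale)
  then have "C a = \<tau> *\<^sub>R A" using A by (simp add: C_K closed)
  \<comment> \<open>The pairing is \<tau> times \<open>ip_V (D (Dstar v)) v\<close>, because
    \<open>C\<close> cancels the \<open>K\<close> in \<open>a\<close>.\<close>
  then have "0 \<le> ip_V (C a) v"
    using \<tau> D_Dstar_nonneg[of v] by (simp add: ip_V_scale_left A_def)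
  then have "seminorm z \<le> seminorm y + seminorm b"
    unfolding z_eq v_eq by (rule weighted_step_bound[OF y b a \<sigma>])
  moreover have "seminorm b = \<tau> * seminorm (K F)"
    using F \<tau> by (simp add: b_def seminorm_scale K_closed)
  moreover have "seminorm x = norm_V C x" for x by (simp add: seminorm_def norm_V_def)
  ultimately show ?thesis using F by (simp add: norm_V_C_K)
qed

end

end

theorem theorem2:
  fixes l1 l2 \<tau> \<sigma> :: real and N1 N2 N :: nat
    and K C :: "grid_vfun \<Rightarrow> grid_vfun"
    and D :: "grid_fun \<Rightarrow> grid_vfun" and Dstar :: "grid_vfun \<Rightarrow> grid_fun"
    and H :: "grid_fun set" and V :: "grid_vfun set"
    and u0 :: grid_fun and \<phi> :: "nat \<Rightarrow> grid_fun" and g :: "nat \<Rightarrow> grid_vfun"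
  assumes grid: "l1 > 0" "l2 > 0" "N1 > 0" "N2 > 0"
    and H: "H = rect_grid.H l1 l2 N1 N2"
    and V: "V = rect_grid.V l1 l2 N1 N2"
    and D: "D = rect_grid.D l1 l2 N1 N2"
    and Dstar: "Dstar = rect_grid.Dstar l1 l2 N1 N2"
    and K_linear: "linear_map_on V V K"
    and K_self_adjoint: "self_adjoint_on V (rect_grid.ip_V l1 l2 N1 N2) K"
    and K_pos_def: "pos_def_on V (rect_grid.ip_V l1 l2 N1 N2) K"
    and C: "C = the_inv_into V K"
    and u0: "u0 \<in> H"
    and N: "N \<ge> 1"
    and tau: "\<tau> > 0"
    and phi: "\<And>n. n < N \<Longrightarrow> \<phi> n \<in> H"
    and g: "\<And>n. n \<le> N \<Longrightarrow> g n \<in> V"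
    and scheme: "\<And>n. n < N \<Longrightarrow>
      C ((1 / \<tau>) *\<^sub>R (g (Suc n) - g n)) + D (Dstar (\<sigma> *\<^sub>R g (Suc n) + (1 - \<sigma>) *\<^sub>R g n)) = D (\<phi> n)"
    and init: "g 0 = K (D u0)"
    and sigma: "\<sigma> \<ge> 1 / 2"
  shows "\<forall>n<N. rect_grid.norm_V l1 l2 N1 N2 C (g (Suc n))
           \<le> rect_grid.norm_V l1 l2 N1 N2 C (g n) + \<tau> * rect_grid.norm_V l1 l2 N1 N2 K (D (\<phi> n))"
proof -
  interpret rect_grid l1 l2 N1 N2 using grid by unfold_locales
  \<comment> \<open>The two copies of \<open>g\<close> supply membership in \<open>V\<close> at
    \<open>n\<close> and \<open>Suc n\<close>; both indices are at most \<open>N\<close> because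
    \<open>n < N\<close>.\<close>
  show ?thesis
    using scheme_step[OF K_linear[unfolded V] K_self_adjoint[unfolded V] K_pos_def[unfolded V]
        g[unfolded V] g[unfolded V] D_in_V tau sigma scheme[unfolded C D Dstar V]]
    by (auto simp: C D V)
qed

end
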